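(* Property (v) does not imply Hausdorff dimension at most $j$: for every $\delta>0$ there is a set $A\subset\mathbb{R}^2$ that has property (v) with respect to $\delta$ for $j=1$ and whose Hausdorff dimension is strictly greater than $1$.
   Context: Property (v) (the $\rho_0$-uniform weak $j$-dimensional $\delta$-approximation property) for a set $A\subset\mathbb{R}^n$ and $\delta>0$: there is $\rho_0>0$ such that $A$ is contained in some ball of radius $\rho_0$ and, for every $y\in A$ and every $\rho\in(0,\rho_0]$, there is a $j$-dimensional affine space $L_{y,\rho}$ containing $y$ with $B_\rho(y)\cap A\subset L_{y,\rho}^{\delta\rho}$, where $L^s:=\{x:|x-z|<s\text{ for some }z\in L\}$ and $B_\rho(y)$ is the open ball. *)

theory Defs
  imports "HOL-Analysis.Analysis"
begin

text \<open>
  The contribution of a bounded covering set to the \<open>s\<close>-dimensional Hausdorff sum, i.e.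
  its diameter to the power \<open>s\<close>.  Since \<open>0 powr 0 = 0\<close> in HOL, the case \<open>s = 0\<close> is listed
  separately, so that the \<open>0\<close>-dimensional measure is counting measure.
\<close>

definition hausdorff_gauge :: "real \<Rightarrow> 'a::metric_space set \<Rightarrow> ennreal" where
  "hausdorff_gauge s U =
     (if U = {} then 0 else if s = 0 then 1 else ennreal (diameter U powr s))"

text \<open>
  The library's \<open>diameter\<close> is only meaningful on bounded sets, hence the boundedness
  condition on the covering sets.  Finite covers are included because the covering sets may
  be empty.
\<close>

definition hausdorff_premeasure :: "real \<Rightarrow> real \<Rightarrow> 'a::metric_space set \<Rightarrow> ennreal" where
  "hausdorff_premeasure s d A =
     Inf {(\<Sum>i. hausdorff_gauge s (U i)) | U :: nat \<Rightarrow> 'a set.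
            A \<subseteq> (\<Union>i. U i) \<and> (\<forall>i. bounded (U i) \<and> diameter (U i) \<le> d)}"

text \<open>
  The Hausdorff outer measure, without the normalising constant, which has no influence on
  the Hausdorff dimension.
\<close>

definition hausdorff_measure :: "real \<Rightarrow> 'a::metric_space set \<Rightarrow> ennreal" where
  "hausdorff_measure s A = (SUP d\<in>{0<..}. hausdorff_premeasure s d A)"

definition hausdorff_dim :: "'a::metric_space set \<Rightarrow> ennreal" where
  "hausdorff_dim A = Inf {ennreal s | s. 0 \<le> s \<and> hausdorff_measure s A = 0}"

definition open_nbhd :: "'a::real_normed_vector set \<Rightarrow> real \<Rightarrow> 'a set" where
  "open_nbhd L s = {x. \<exists>z\<in>L. norm (x - z) < s}"

text \<open>
  The \<open>\<rho>\<^sub>0\<close>-uniform weak \<open>j\<close>-dimensional \<open>\<delta>\<close>-approximation property, for some \<open>\<rho>\<^sub>0 > 0\<close>: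
  the affine space may depend on both the point and the radius.
\<close>

definition uniform_weak_approx :: "nat \<Rightarrow> real \<Rightarrow> 'a::euclidean_space set \<Rightarrow> bool" where
  "uniform_weak_approx j \<delta> A \<longleftrightarrow>
     (\<exists>\<rho>\<^sub>0>0. (\<exists>c. A \<subseteq> ball c \<rho>\<^sub>0) \<and>
        (\<forall>y\<in>A. \<forall>\<rho>\<in>{0<..\<rho>\<^sub>0}. \<exists>L. affine L \<and> aff_dim L = int j \<and> y \<in> L \<and>
           ball y \<rho> \<inter> A \<subseteq> open_nbhd L (\<delta> * \<rho>)))"

end

theory Submission
  imports Defs
begin

text \<open>
  The set is a Koch curve with a small base angle \<open>arctan \<tau>\<close>, of self-similarity ratio
  \<open>p = sqrt (1 + \<tau>\<^sup>2) / 2 > 1 / 2\<close>.  Adjacent edges of its \<open>n\<close>-th polygon differ in direction by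
  \<open>O(\<tau>)\<close> and the curve stays within \<open>O(\<tau> p\<^sup>n)\<close> of that polygon, so on every parameter interval of
  length \<open>2\<^sup>-\<^sup>n\<close> the parametrisation is affine up to \<open>O(\<tau> p\<^sup>n)\<close>, with a linear part of norm
  \<open>(2 p)\<^sup>n\<close>.  For small \<open>\<tau>\<close> this gives two things.  Parameters at distance about \<open>2\<^sup>-\<^sup>n\<close> have
  images at distance at least \<open>p\<^sup>n / 4\<close>, so the inverse of the parametrisation is Hoelder with
  exponent \<open>s = log (1 / p) 2 > 1\<close>, and pulling covers back to \<open>[0, 1]\<close> bounds the dimension below
  by \<open>s\<close>.  Conversely, the part of the curve in a ball of radius about \<open>p\<^sup>n\<close> comes from parameters
  at distance at most \<open>2\<^sup>-\<^sup>n\<close>, so it lies within \<open>O(\<tau> p\<^sup>n)\<close> of a line.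
\<close>

section \<open>Lower bounds for the Hausdorff dimension\<close>

text \<open>The parameters that \<open>g\<close> sends into a covering set \<open>U\<close> lie in
  an interval of length \<open>2 * C * diameter U powr s0\<close>. These intervals cover
  \<open>{0..1}\<close>, whose Lebesgue measure 1 bounds every Hausdorff sum from below.\<close>

lemma hausdorff_measure_pos_of_expanding:
  fixes g :: "real \<Rightarrow> 'a::metric_space"
  assumes C: "C > 0" and s: "0 \<le> s" "s \<le> s0"
    and expand: "\<And>t u. \<lbrakk>t \<in> {0..1}; u \<in> {0..1}\<rbrakk> \<Longrightarrow> \<bar>u - t\<bar> \<le> C * dist (g t) (g u) powr s0"
  shows "hausdorff_measure s (g ` {0..1}) > 0"
proof -
  define J where "J U = {t \<in> {0..1}. g t \<in> U}" for U
  have cover_piece: "\<exists>I. I \<in> sets lborel \<and> J U \<subseteq> I \<and>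
      emeasure lborel I \<le> ennreal (2 * C) * hausdorff_gauge s U"
    if U: "bounded U" "diameter U \<le> 1" for U
  proof (cases "J U = {}")
    case True
    then show ?thesis by (intro exI[of _ "{}"]) auto
  next
    case False
    then obtain t0 where t0: "t0 \<in> {0..1}" "g t0 \<in> U" by (auto simp: J_def)
    define r where "r = C * diameter U powr s0"
    have diam: "0 \<le> diameter U" by (rule diameter_ge_0[OF U(1)])
    have r: "0 \<le> r" using C by (simp add: r_def)
    have "\<bar>u - t0\<bar> \<le> r" if "u \<in> J U" for u
    proof -
      have "\<bar>u - t0\<bar> \<le> C * dist (g t0) (g u) powr s0"
        using that t0 by (intro expand) (auto simp: J_def)
      also have "\<dots> \<le> r"
        unfolding r_def using that t0 C s
        by (intro mult_left_mono powr_mono2 diameter_bounded_bound[OF U(1)]) (auto simp: J_def)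
      finally show ?thesis .
    qed
    then have sub: "J U \<subseteq> {t0 - r..t0 + r}" by (auto simp: abs_le_iff algebra_simps)
    \<comment> \<open>Diameters at most 1 make the power decrease in the exponent; for
      \<open>s = 0\<close> the gauge is 1.\<close>
    have gauge: "ennreal (diameter U powr s0) \<le> hausdorff_gauge s U"
      using t0 s U(2) diam powr_mono'[of s s0 "diameter U"] powr_le1[of s0 "diameter U"]
      by (auto simp: hausdorff_gauge_def intro!: ennreal_leI)
    have "emeasure lborel {t0 - r..t0 + r} = ennreal (2 * C) * ennreal (diameter U powr s0)"
      using r C by (simp add: r_def ennreal_mult'[symmetric] algebra_simps)
    also have "\<dots> \<le> ennreal (2 * C) * hausdorff_gauge s U"
      by (intro mult_left_mono gauge) auto
    finally show ?thesis using sub by (intro exI[of _ "{t0 - r..t0 + r}"]) auto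
  qed
  have sum_ge: "ennreal (1 / (2 * C)) \<le> (\<Sum>i. hausdorff_gauge s (U i))"
    if U: "g ` {0..1} \<subseteq> (\<Union>i. U i)" "\<And>i::nat. bounded (U i) \<and> diameter (U i) \<le> 1" for U
  proof -
    obtain I where I: "\<And>i. I i \<in> sets lborel" "\<And>i. J (U i) \<subseteq> I i"
      "\<And>i. emeasure lborel (I i) \<le> ennreal (2 * C) * hausdorff_gauge s (U i)"
      using cover_piece[of "U _"] U(2) by metis
    have "{0..1} \<subseteq> (\<Union>i. I i)"
    proof
      fix t :: real assume t: "t \<in> {0..1}"
      then obtain i where "g t \<in> U i" using U(1) by blast
      then show "t \<in> (\<Union>i. I i)" using I(2)[of i] t by (auto simp: J_def)
    qed
    then have "emeasure lborel {0..1::real} \<le> emeasure lborel (\<Union>i. I i)"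
      using I(1) by (intro emeasure_mono) auto
    also have "\<dots> \<le> (\<Sum>i. emeasure lborel (I i))"
      using I(1) by (intro emeasure_subadditive_countably) auto
    also have "\<dots> \<le> (\<Sum>i. ennreal (2 * C) * hausdorff_gauge s (U i))"
      by (intro suminf_le I(3)) auto
    finally have "1 \<le> ennreal (2 * C) * (\<Sum>i. hausdorff_gauge s (U i))" by simp
    then have "ennreal (1 / (2 * C)) * 1
        \<le> ennreal (1 / (2 * C)) * (ennreal (2 * C) * (\<Sum>i. hausdorff_gauge s (U i)))"
      by (intro mult_left_mono) auto
    also have "\<dots> = (\<Sum>i. hausdorff_gauge s (U i))"
      using C by (simp add: mult.assoc[symmetric] ennreal_mult'[symmetric])
    finally show ?thesis by simp
  qed
  have "0 < ennreal (1 / (2 * C))" using C by simp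
  also have "\<dots> \<le> hausdorff_premeasure s 1 (g ` {0..1})"
    unfolding hausdorff_premeasure_def by (rule Inf_greatest) (use sum_ge in blast)
  also have "\<dots> \<le> hausdorff_measure s (g ` {0..1})"
    unfolding hausdorff_measure_def by (rule SUP_upper) auto
  finally show ?thesis .
qed

lemma hausdorff_dim_ge_of_expanding:
  fixes g :: "real \<Rightarrow> 'a::metric_space"
  assumes "C > 0"
    and "\<And>t u. \<lbrakk>t \<in> {0..1}; u \<in> {0..1}\<rbrakk> \<Longrightarrow> \<bar>u - t\<bar> \<le> C * dist (g t) (g u) powr s0"
  shows "ennreal s0 \<le> hausdorff_dim (g ` {0..1})"
  unfolding hausdorff_dim_def
proof (rule Inf_greatest, clarify)
  fix s :: real
  assume s: "0 \<le> s" "hausdorff_measure s (g ` {0..1}) = 0"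
  have "\<not> s \<le> s0"
    using hausdorff_measure_pos_of_expanding[of C s s0 g] assms s by auto
  then show "ennreal s0 \<le> ennreal s" by (intro ennreal_leI) simp
qed

section \<open>A flat Koch curve\<close>

text \<open>
  At step \<open>n\<close> every edge is replaced by the two equal sides of an isosceles triangle with base
  angle \<open>arctan \<tau>\<close>.  The sides of the edges on which the triangles are erected alternate with
  \<open>n\<close>, as in the Koch curve; this keeps the directions of adjacent edges close.
\<close>

primrec edge_angle :: "nat \<Rightarrow> int \<Rightarrow> int" where
  "edge_angle 0 k = 0"
| "edge_angle (Suc n) k = edge_angle n (k div 2) + (if even k = even n then 1 else - 1)"

text \<open>Up to the sign, the turn created in the middle of an edge is 2, while a turn
  \<open>x\<close> at an old vertex becomes \<open>- x - 2\<close>. Alternating the sides makes this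
  map an involution, which swaps 0 with -2 and 2 with -4, so turns do not accumulate.\<close>

lemma edge_angle_step:
  "(- 1) ^ n * (edge_angle n (k + 1) - edge_angle n k) \<in> {0, -2, 2, -4}"
proof (induction n arbitrary: k)
  case (Suc n)
  show ?case
  proof (cases "even k")
    case True
    then obtain j where "k = 2 * j" by (rule evenE)
    then show ?thesis by (cases "even n") auto
  next
    case False
    then obtain j where k: "k = 2 * j + 1" by (rule oddE)
    have "(2 * j + 1 + 1) div 2 = j + 1" "(2 * j + 1) div 2 = j" by presburger+
    then have "edge_angle (Suc n) (k + 1) - edge_angle (Suc n) k
        = (edge_angle n (j + 1) - edge_angle n j) + 2 * (if even n then 1 else - 1)"
      by (simp add: k add.commute)
    with Suc.IH[of j] show ?thesis by (cases "even n") auto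
  qed
qed simp

lemma edge_angle_adjacent:
  assumes "\<bar>j - k\<bar> \<le> 1"
  shows "\<bar>edge_angle n j - edge_angle n k\<bar> \<le> 4"
proof -
  have step: "\<bar>edge_angle n (i + 1) - edge_angle n i\<bar> \<le> 4" for i
    using edge_angle_step[of n i] by (cases "even n") auto
  consider "j = k" | "j = k + 1" | "k = j + 1" using assms by linarith
  then show ?thesis using step[of k] step[of j] by cases auto
qed

lemma norm_cis_diff_le: "norm (cis a - cis b) \<le> \<bar>a - b\<bar>"
proof -
  have "cis a - cis b = cis b * (cis (a - b) - 1)"
    by (simp add: right_diff_distrib cis_mult)
  then have "norm (cis a - cis b) = norm (exp (\<i> * of_real (a - b)) - 1)"
    by (simp only: norm_mult norm_cis mult_1) (simp only: cis_conv_exp)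
  also have "\<dots> = 2 * \<bar>sin ((a - b) / 2)\<bar>" by (rule dist_exp_i_1)
  also have "\<dots> \<le> \<bar>a - b\<bar>" using abs_sin_x_le_abs_x[of "(a - b) / 2"] by simp
  finally show ?thesis .
qed

lemma one_plus_i_arctan:
  "1 + \<i> * of_real \<tau> = of_real (sqrt (1 + \<tau>\<^sup>2)) * cis (arctan \<tau>)"
proof -
  have "sqrt (1 + \<tau>\<^sup>2) \<noteq> 0"
    using add_pos_nonneg[of 1 "\<tau>\<^sup>2"] by simp
  then show ?thesis by (simp add: complex_eq_iff cos_arctan sin_arctan)
qed

section \<open>The polygons and their edges\<close>

locale flat_koch =
  fixes \<tau> :: real
  assumes pos: "0 < \<tau>" and small: "\<tau> \<le> 1 / 32"
begin

definition stretch :: real where "stretch = sqrt (1 + \<tau>\<^sup>2)"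

definition ratio :: real where "ratio = stretch / 2"

text \<open>The edges of the \<open>n\<close>-th polygon are the images of the intervals \<open>[k / 2 ^ n, (k + 1) / 2 ^ n]\<close>.\<close>

definition slope :: "nat \<Rightarrow> int \<Rightarrow> complex" where
  "slope n k = of_real (stretch ^ n) * cis (arctan \<tau> * edge_angle n k)"

text \<open>A tent over each edge of the \<open>n\<close>-th polygon, raised along the normal
  \<open>\<i> * slope n k\<close> and zero at the vertices; \<open>(- 1) ^ n\<close> alternates the
  side.\<close>

definition bump :: "nat \<Rightarrow> real \<Rightarrow> complex" where
  "bump n t = \<i> * of_real (\<tau> * (- 1) ^ n * (min (frac (2 ^ n * t)) (1 - frac (2 ^ n * t)) / 2 ^ n))
     * slope n \<lfloor>2 ^ n * t\<rfloor>"

definition polygon :: "nat \<Rightarrow> real \<Rightarrow> complex" where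
  "polygon n t = of_real t + (\<Sum>m<n. bump m t)"

definition curve :: "real \<Rightarrow> complex" where
  "curve t = of_real t + (\<Sum>m. bump m t)"

lemma stretch_gt_1: "1 < stretch"
  using pos by (simp add: stretch_def)

lemma ratio_gt: "1 / 2 < ratio"
  using stretch_gt_1 by (simp add: ratio_def)

lemma ratio_le: "ratio \<le> 3 / 4"
proof -
  have "\<tau>\<^sup>2 \<le> 1\<^sup>2" using pos small by (intro power_mono) auto
  then have "stretch \<le> 3 / 2"
    unfolding stretch_def by (intro real_le_lsqrt) (auto simp: power2_eq_square)
  then show ?thesis by (simp add: ratio_def)
qed

lemma ratio_pos: "0 < ratio"
  using ratio_gt by simp

lemma norm_slope: "norm (slope n k) = stretch ^ n"
  using stretch_gt_1 by (simp add: slope_def norm_mult norm_power)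

lemma stretch_power: "stretch ^ n / 2 ^ n = ratio ^ n"
  by (simp add: ratio_def power_divide)

lemma slope_nonzero: "slope n k \<noteq> 0"
  using norm_slope[of n k] stretch_gt_1 by auto

text \<open>The tent has opposite slopes on the two halves of an edge, so the derivative is
  multiplied by \<open>1 + \<i> * of_real \<tau>\<close> or its conjugate: a dilation by
  \<open>stretch\<close> and a rotation by \<open>arctan \<tau>\<close> in either sense.\<close>

lemma slope_Suc:
  "slope (Suc n) k = slope n (k div 2) * (1 + \<i> * of_real (\<tau> * (- 1) ^ n * (if even k then 1 else - 1)))"
proof -
  define \<sigma> :: real where "\<sigma> = (if even k = even n then 1 else - 1)"
  have \<sigma>: "(- 1) ^ n * (if even k then 1 else - 1) = \<sigma>" by (auto simp: \<sigma>_def)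
  have "1 + \<i> * of_real (\<tau> * \<sigma>) = of_real stretch * cis (arctan \<tau> * \<sigma>)"
    using one_plus_i_arctan[of \<tau>] one_plus_i_arctan[of "- \<tau>"]
    by (auto simp: \<sigma>_def stretch_def arctan_minus)
  moreover have "arctan \<tau> * edge_angle (Suc n) k = arctan \<tau> * edge_angle n (k div 2) + arctan \<tau> * \<sigma>"
    by (auto simp: \<sigma>_def algebra_simps)
  ultimately show ?thesis
    unfolding slope_def mult.assoc[of \<tau>] \<sigma> by (simp add: cis_mult[symmetric] mult_ac)
qed

lemma norm_slope_adjacent:
  assumes "\<bar>j - k\<bar> \<le> 1"
  shows "norm (slope n j - slope n k) \<le> 4 * \<tau> * stretch ^ n"
proof -
  have "norm (slope n j - slope n k)
      = stretch ^ n * norm (cis (arctan \<tau> * edge_angle n j) - cis (arctan \<tau> * edge_angle n k))"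
    using stretch_gt_1 by (simp add: slope_def right_diff_distrib[symmetric] norm_mult norm_power)
  also have "\<dots> \<le> stretch ^ n * \<bar>arctan \<tau> * edge_angle n j - arctan \<tau> * edge_angle n k\<bar>"
    using stretch_gt_1 by (intro mult_left_mono norm_cis_diff_le) auto
  also have "\<dots> = stretch ^ n * (\<bar>arctan \<tau>\<bar> * real_of_int \<bar>edge_angle n j - edge_angle n k\<bar>)"
    by (simp add: right_diff_distrib[symmetric] abs_mult)
  also have "\<dots> \<le> stretch ^ n * (\<tau> * 4)"
    using stretch_gt_1 abs_arctan_le[of \<tau>] pos edge_angle_adjacent[OF assms, of n]
    by (intro mult_left_mono mult_mono) auto
  finally show ?thesis by (simp add: mult_ac)
qed

lemma bump_on_interval:
  assumes "of_int k \<le> 2 ^ n * t" "2 ^ n * t \<le> of_int k + 1"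
  shows "bump n t = \<i> * of_real (\<tau> * (- 1) ^ n * (min (2 ^ n * t - k) (k + 1 - 2 ^ n * t) / 2 ^ n))
     * slope n k"
proof (cases "2 ^ n * t = of_int k + 1")
  case True
  \<comment> \<open>At the right endpoint the floor is already \<open>k + 1\<close>, but the tents
    on both sides vanish there.\<close>
  then have "2 ^ n * t = of_int (k + 1)" by simp
  then show ?thesis unfolding bump_def by simp
next
  case False
  then have "\<lfloor>2 ^ n * t\<rfloor> = k" using assms by (intro floor_unique) auto
  then show ?thesis by (simp add: bump_def frac_def algebra_simps)
qed

text \<open>By induction: an interval of level \<open>Suc n\<close> is one half of an interval of
  level \<open>n\<close>, and on each half the added tent is affine as well.\<close>

lemma polygon_affine:
  assumes "of_int k \<le> 2 ^ n * t" "2 ^ n * t \<le> of_int k + 1"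
    and "of_int k \<le> 2 ^ n * u" "2 ^ n * u \<le> of_int k + 1"
  shows "polygon n u - polygon n t = slope n k * of_real (u - t)"
  using assms
proof (induction n arbitrary: k)
  case 0
  then show ?case by (simp add: polygon_def slope_def)
next
  case (Suc n)
  define j where "j = k div 2"
  define \<sigma> :: real where "\<sigma> = (if even k then 1 else - 1)"
  have k: "k = 2 * j + (if even k then 0 else 1)" unfolding j_def by presburger
  have half: "of_int j \<le> 2 ^ n * x" "2 ^ n * x \<le> of_int j + 1"
    "min (2 ^ n * x - j) (j + 1 - 2 ^ n * x) = \<sigma> * (2 ^ n * x - j) + (if even k then 0 else 1)"
    if "of_int k \<le> 2 ^ Suc n * x" "2 ^ Suc n * x \<le> of_int k + 1" for x :: real
  proof -
    define z where "z = 2 ^ n * x"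
    have kz: "of_int k = 2 * of_int j + (if even k then 0 else 1 :: real)"
      by (subst k) auto
    have "of_int k \<le> 2 * z" "2 * z \<le> of_int k + 1" using that by (simp_all add: z_def)
    then show "of_int j \<le> 2 ^ n * x" "2 ^ n * x \<le> of_int j + 1"
      "min (2 ^ n * x - j) (j + 1 - 2 ^ n * x) = \<sigma> * (2 ^ n * x - j) + (if even k then 0 else 1)"
      unfolding z_def[symmetric] \<sigma>_def kz by (auto simp: min_def split: if_splits)
  qed
  have b: "bump n x = \<i> * of_real (\<tau> * (- 1) ^ n *
      ((\<sigma> * (2 ^ n * x - j) + (if even k then 0 else 1)) / 2 ^ n)) * slope n j"
    if "of_int k \<le> 2 ^ Suc n * x" "2 ^ Suc n * x \<le> of_int k + 1" for x :: real
    using bump_on_interval[OF half(1,2)[OF that]] half(3)[OF that] by simp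
  have "bump n u - bump n t = \<i> * of_real (\<tau> * (- 1) ^ n * \<sigma> * (u - t)) * slope n j"
    unfolding b[OF Suc.prems(1,2)] b[OF Suc.prems(3,4)]
    by (simp add: field_simps)
  moreover have "polygon n u - polygon n t = slope n j * of_real (u - t)"
    using Suc.IH half(1,2)[OF Suc.prems(1,2)] half(1,2)[OF Suc.prems(3,4)] by blast
  moreover have "polygon (Suc n) u - polygon (Suc n) t = (polygon n u - polygon n t) + (bump n u - bump n t)"
    by (simp add: polygon_def)
  ultimately have "polygon (Suc n) u - polygon (Suc n) t
      = slope n j * of_real (u - t) + \<i> * of_real (\<tau> * (- 1) ^ n * \<sigma> * (u - t)) * slope n j"
    by simp
  also have "\<dots> = slope (Suc n) k * of_real (u - t)"
    unfolding slope_Suc j_def[symmetric] \<sigma>_def[symmetric] by (simp add: algebra_simps)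
  finally show ?case .
qed

section \<open>Distance between the curve and its polygons\<close>

lemma norm_bump_le: "norm (bump n t) \<le> \<tau> / 2 * ratio ^ n"
proof -
  define f where "f = frac (2 ^ n * t)"
  have f: "0 \<le> f" "f < 1" by (simp_all add: f_def frac_lt_1)
  have "norm (bump n t) = \<bar>\<tau> * (- 1) ^ n * (min f (1 - f) / 2 ^ n)\<bar> * stretch ^ n"
    by (simp only: bump_def f_def[symmetric] norm_mult norm_slope norm_of_real norm_ii mult_1)
  also have "\<dots> = \<tau> * min f (1 - f) * (stretch ^ n / 2 ^ n)"
    using pos f by (simp add: abs_mult)
  also have "\<dots> \<le> \<tau> * (1 / 2) * (stretch ^ n / 2 ^ n)"
    using pos f stretch_gt_1 by (intro mult_right_mono mult_left_mono) (auto simp: min_def)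
  finally show ?thesis by (simp add: stretch_power)
qed

text \<open>The remaining bumps are dominated by a geometric series, and
  \<open>ratio \<le> 3 / 4\<close> bounds its factor \<open>1 / (1 - ratio)\<close> by 4.\<close>

lemma curve_approx_polygon: "norm (curve t - polygon n t) \<le> 2 * \<tau> * ratio ^ n"
proof -
  have geo: "(\<lambda>m. \<tau> / 2 * ratio ^ n * ratio ^ m) sums (\<tau> / 2 * ratio ^ n * (1 / (1 - ratio)))"
    using ratio_pos ratio_le by (intro sums_mult geometric_sums) auto
  have le: "norm (bump (m + n) t) \<le> \<tau> / 2 * ratio ^ n * ratio ^ m" for m
    using norm_bump_le[of "m + n" t] by (simp add: power_add mult_ac)
  have "summable (\<lambda>m. bump (m + n) t)"
    by (rule summable_comparison_test'[OF sums_summable[OF geo], of 0]) (rule le)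
  then have "summable (\<lambda>m. bump m t)" using summable_iff_shift[of "\<lambda>m. bump m t" n] by blast
  then have "curve t - polygon n t = (\<Sum>m. bump (m + n) t)"
    unfolding curve_def polygon_def by (subst suminf_split_initial_segment[of _ n]) auto
  also have "norm \<dots> \<le> (\<Sum>m. \<tau> / 2 * ratio ^ n * ratio ^ m)"
    by (rule norm_suminf_le[OF le sums_summable[OF geo]])
  also have "\<dots> = \<tau> / 2 * ratio ^ n * (1 / (1 - ratio))"
    using geo by (rule sums_unique[symmetric])
  also have "\<dots> \<le> \<tau> / 2 * ratio ^ n * 4"
    using pos ratio_pos ratio_le by (intro mult_left_mono) (auto simp: field_simps)
  finally show ?thesis by simp
qed

text \<open>If \<open>u\<close> lies over a neighbouring edge, pass through the common vertex
  \<open>c\<close>: the error is the difference of the two slopes times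
  \<open>u - c\<close>.\<close>

lemma polygon_almost_affine:
  assumes tu: "\<bar>u - t\<bar> \<le> 1 / 2 ^ n"
  shows "norm (polygon n u - polygon n t - slope n \<lfloor>2 ^ n * t\<rfloor> * of_real (u - t)) \<le> 4 * \<tau> * ratio ^ n"
proof -
  define k where "k = \<lfloor>2 ^ n * t\<rfloor>"
  have k: "of_int k \<le> 2 ^ n * t" "2 ^ n * t \<le> of_int k + 1"
    unfolding k_def by linarith+
  have tu': "\<bar>2 ^ n * u - 2 ^ n * t\<bar> \<le> 1"
    unfolding right_diff_distrib[symmetric] abs_mult using tu by (simp add: field_simps)
  obtain j c where j: "\<bar>j - k\<bar> \<le> 1" "of_int j \<le> 2 ^ n * u" "2 ^ n * u \<le> of_int j + 1"
    and c: "of_int j \<le> 2 ^ n * c" "2 ^ n * c \<le> of_int j + 1"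
      "of_int k \<le> 2 ^ n * c" "2 ^ n * c \<le> of_int k + 1" "\<bar>u - c\<bar> \<le> \<bar>u - t\<bar>"
  proof -
    consider "2 ^ n * u < of_int k" | "of_int k \<le> 2 ^ n * u" "2 ^ n * u \<le> of_int k + 1"
      | "of_int k + 1 < 2 ^ n * u" by linarith
    then show ?thesis
    proof cases
      case 1
      then have "u \<le> of_int k / 2 ^ n" "of_int k / 2 ^ n \<le> t" using k by (auto simp: field_simps)
      with 1 k tu' show ?thesis by (intro that[of "k - 1" "of_int k / 2 ^ n"]) auto
    next
      case 2
      with k show ?thesis by (intro that[of k t]) auto
    next
      case 3
      then have "of_int (k + 1) / 2 ^ n \<le> u" "t \<le> of_int (k + 1) / 2 ^ n"
        using k by (auto simp: field_simps)
      with 3 k tu' show ?thesis by (intro that[of "k + 1" "of_int (k + 1) / 2 ^ n"]) auto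
    qed
  qed
  have "polygon n u - polygon n t - slope n k * of_real (u - t)
      = (polygon n u - polygon n c) + (polygon n c - polygon n t) - slope n k * of_real (u - t)"
    by simp
  also have "\<dots> = (slope n j - slope n k) * of_real (u - c)"
    unfolding polygon_affine[OF c(1,2) j(2,3)] polygon_affine[OF k c(3,4)]
    by (simp add: algebra_simps)
  also have "norm \<dots> \<le> (4 * \<tau> * stretch ^ n) * (1 / 2 ^ n)"
    unfolding norm_mult norm_of_real using pos stretch_gt_1 c(5) tu
    by (intro mult_mono norm_slope_adjacent j(1)) auto
  also have "\<dots> = 4 * \<tau> * ratio ^ n" by (simp add: stretch_power[symmetric])
  finally show ?thesis by (simp only: k_def)
qed

lemma curve_almost_affine:
  assumes tu: "\<bar>u - t\<bar> \<le> 1 / 2 ^ n"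
  shows "norm (curve u - curve t - slope n \<lfloor>2 ^ n * t\<rfloor> * of_real (u - t)) \<le> 8 * \<tau> * ratio ^ n"
proof -
  have "curve u - curve t - slope n \<lfloor>2 ^ n * t\<rfloor> * of_real (u - t)
    = (curve u - polygon n u) - (curve t - polygon n t)
      + (polygon n u - polygon n t - slope n \<lfloor>2 ^ n * t\<rfloor> * of_real (u - t))" by simp
  also have "norm \<dots> \<le> (2 * \<tau> * ratio ^ n + 2 * \<tau> * ratio ^ n) + 4 * \<tau> * ratio ^ n"
    by (intro norm_triangle_mono norm_triangle_le_diff add_mono curve_approx_polygon
          polygon_almost_affine tu)
  finally show ?thesis by simp
qed

text \<open>The linear part has length at least \<open>ratio ^ n / 2\<close>, and
  \<open>\<tau> \<le> 1 / 32\<close> keeps the error \<open>8 * \<tau> * ratio ^ n\<close> within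
  half of that.\<close>

lemma curve_expanding:
  assumes "\<bar>u - t\<bar> \<le> 1 / 2 ^ n" "1 / 2 ^ Suc n < \<bar>u - t\<bar>"
  shows "ratio ^ n / 4 \<le> norm (curve u - curve t)"
proof -
  have "ratio ^ n / 2 = stretch ^ n * (1 / 2 ^ Suc n)"
    by (simp add: stretch_power[symmetric])
  also have "\<dots> \<le> stretch ^ n * \<bar>u - t\<bar>"
    using assms stretch_gt_1 by (intro mult_left_mono) auto
  also have "\<dots> = norm (slope n \<lfloor>2 ^ n * t\<rfloor> * of_real (u - t))"
    by (simp only: norm_mult norm_slope norm_of_real)
  also have "\<dots> \<le> norm (curve u - curve t) + 8 * \<tau> * ratio ^ n"
    using norm_triangle_sub[of "slope n \<lfloor>2 ^ n * t\<rfloor> * of_real (u - t)" "curve u - curve t"]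
      norm_minus_commute[of "slope n \<lfloor>2 ^ n * t\<rfloor> * of_real (u - t)" "curve u - curve t"]
      curve_almost_affine[OF assms(1)] by linarith
  also have "8 * \<tau> * ratio ^ n \<le> 1 / 4 * ratio ^ n"
    using small ratio_pos by (intro mult_right_mono) auto
  finally show ?thesis by simp
qed

section \<open>Dyadic scales and the Hoelder exponent\<close>

lemma dyadic_scale:
  fixes t u :: real
  assumes "t \<in> {0..1}" "u \<in> {0..1}" "u \<noteq> t"
  obtains n where "\<bar>u - t\<bar> \<le> 1 / 2 ^ n" "1 / 2 ^ Suc n < \<bar>u - t\<bar>"
proof -
  define n where "n = (LEAST n. (1 / 2) ^ Suc n < \<bar>u - t\<bar>)"
  obtain m where "(1 / 2) ^ m < \<bar>u - t\<bar>"
    using real_arch_pow_inv[of "\<bar>u - t\<bar>" "1 / 2"] assms(3) by auto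
  moreover have "(1 / 2 :: real) ^ Suc m \<le> (1 / 2) ^ m" by simp
  ultimately have "(1 / 2) ^ Suc m < \<bar>u - t\<bar>" by linarith
  then have n: "(1 / 2) ^ Suc n < \<bar>u - t\<bar>" unfolding n_def by (rule LeastI)
  have "\<bar>u - t\<bar> \<le> (1 / 2) ^ n"
  proof (cases n)
    case 0
    with assms show ?thesis by auto
  next
    case (Suc k)
    then show ?thesis using not_less_Least[of k "\<lambda>n. (1 / 2) ^ Suc n < \<bar>u - t\<bar>"]
      unfolding n_def[symmetric] by simp
  qed
  with n show ?thesis by (intro that[of n]) (simp_all add: power_one_over)
qed

text \<open>The similarity dimension for two copies scaled by \<open>ratio\<close>: the solution
  \<open>s\<close> of \<open>2 * ratio powr s = 1\<close>.\<close>

definition koch_dim :: real where "koch_dim = log (1 / ratio) 2"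

lemma koch_dim_gt_1: "1 < koch_dim"
proof -
  have "log (1 / ratio) (1 / ratio) < log (1 / ratio) 2"
    using ratio_gt ratio_le by (subst log_less_cancel_iff) (auto simp: field_simps)
  then show ?thesis using ratio_pos ratio_le by (simp add: koch_dim_def)
qed

lemma ratio_powr_koch_dim: "(ratio ^ n) powr koch_dim = 1 / 2 ^ n"
proof -
  have "(1 / ratio) powr koch_dim = 2"
    unfolding koch_dim_def using ratio_pos ratio_le by (intro powr_log_cancel) auto
  then have base: "ratio powr koch_dim = 1 / 2"
    using ratio_pos by (simp add: powr_divide field_simps)
  have "(ratio ^ n) powr koch_dim = (ratio powr real n) powr koch_dim"
    using ratio_pos by (simp only: powr_realpow)
  also have "\<dots> = (ratio powr koch_dim) powr real n" by (rule powr_powr_swap)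
  also have "\<dots> = 1 / 2 ^ n" unfolding base by (simp add: powr_realpow power_one_over)
  finally show ?thesis .
qed

text \<open>At the dyadic scale \<open>n\<close> of \<open>u - t\<close> the images are at least
  \<open>ratio ^ n / 4\<close> apart, and raising \<open>ratio ^ n\<close> to
  \<open>koch_dim\<close> gives back \<open>1 / 2 ^ n\<close>.\<close>

lemma curve_inverse_holder:
  assumes "t \<in> {0..1}" "u \<in> {0..1}"
  shows "\<bar>u - t\<bar> \<le> 4 powr koch_dim * dist (curve t) (curve u) powr koch_dim"
proof (cases "u = t")
  case False
  then obtain n where n: "\<bar>u - t\<bar> \<le> 1 / 2 ^ n" "1 / 2 ^ Suc n < \<bar>u - t\<bar>"
    using dyadic_scale assms by blast
  have "\<bar>u - t\<bar> \<le> (ratio ^ n) powr koch_dim" using n(1) by (simp add: ratio_powr_koch_dim)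
  also have "\<dots> \<le> (4 * dist (curve t) (curve u)) powr koch_dim"
    using curve_expanding[OF n] ratio_pos koch_dim_gt_1
    by (intro powr_mono2) (auto simp: dist_norm norm_minus_commute)
  finally show ?thesis by (simp add: powr_mult)
qed simp

section \<open>Boundedness, and flatness at every point and scale\<close>

lemma norm_curve_less:
  assumes "t \<in> {0..1}"
  shows "norm (curve t) < 2"
proof -
  have "norm (curve t) \<le> norm (polygon 0 t) + 2 * \<tau>"
    using norm_triangle_sub[of "curve t" "polygon 0 t"] curve_approx_polygon[of t 0] by simp
  then show ?thesis using assms small by (simp add: polygon_def)
qed

text \<open>Take the least \<open>n\<close> with \<open>ratio ^ Suc n / 4 < \<rho>\<close>.
  Expansion confines the part of the curve in the ball to parameters within \<open>1 / 2 ^ n\<close>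
  of \<open>t\<close>, where the curve is affine up to an error comparable to
  \<open>\<tau> * \<rho>\<close>.\<close>

lemma curve_locally_flat:
  assumes t: "t \<in> {0..1}" and \<rho>: "0 < \<rho>" "\<rho> \<le> 2"
  obtains d where "d \<noteq> 0"
    "\<And>u. \<lbrakk>u \<in> {0..1}; norm (curve u - curve t) < \<rho>\<rbrakk>
      \<Longrightarrow> norm (curve u - (curve t + d * of_real (u - t))) < 64 * \<tau> * \<rho>"
proof -
  define n where "n = (LEAST n. ratio ^ Suc n / 4 < \<rho>)"
  obtain m where m: "ratio ^ m < 4 * \<rho>"
    using real_arch_pow_inv[of "4 * \<rho>" ratio] \<rho> ratio_le by auto
  have "ratio ^ Suc m \<le> ratio ^ m"
    using ratio_pos ratio_le by (intro power_decreasing) auto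
  with m have "ratio ^ Suc m / 4 < \<rho>" by linarith
  then have n: "ratio ^ Suc n / 4 < \<rho>" unfolding n_def by (rule LeastI)
  \<comment> \<open>For \<open>n = 0\<close> this bound can fail, but parameters in
    \<open>{0..1}\<close> are within 1 of each other anyway.\<close>
  have n': "\<rho> \<le> ratio ^ n / 4" if "n \<noteq> 0"
  proof -
    obtain k where k: "n = Suc k" using \<open>n \<noteq> 0\<close> by (cases n) auto
    show ?thesis using not_less_Least[of k "\<lambda>n. ratio ^ Suc n / 4 < \<rho>"] k
      unfolding n_def[symmetric] by simp
  qed
  have near: "\<bar>u - t\<bar> \<le> 1 / 2 ^ n" if u: "u \<in> {0..1}" "norm (curve u - curve t) < \<rho>" for u
  proof (cases "u = t \<or> n = 0")
    case True
    then show ?thesis using t u by auto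
  next
    case False
    then obtain m where m: "\<bar>u - t\<bar> \<le> 1 / 2 ^ m" "1 / 2 ^ Suc m < \<bar>u - t\<bar>"
      using dyadic_scale t u by blast
    have "n \<le> m"
    proof (rule ccontr)
      assume "\<not> n \<le> m"
      then have "ratio ^ n \<le> ratio ^ m"
        using ratio_pos ratio_le by (intro power_decreasing) auto
      with curve_expanding[OF m] n' False u show False by auto
    qed
    then have "(1 :: real) / 2 ^ m \<le> 1 / 2 ^ n" by (simp add: field_simps)
    with m show ?thesis by linarith
  qed
  show ?thesis
  proof (rule that[of "slope n \<lfloor>2 ^ n * t\<rfloor>"])
    fix u assume u: "u \<in> {0..1}" "norm (curve u - curve t) < \<rho>"
    have "norm (curve u - (curve t + slope n \<lfloor>2 ^ n * t\<rfloor> * of_real (u - t))) \<le> 8 * \<tau> * ratio ^ n"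
      using curve_almost_affine[OF near[OF u]] by (simp add: algebra_simps)
    \<comment> \<open>Since \<open>ratio > 1 / 2\<close>, one level costs a factor 2; then
      \<open>ratio ^ Suc n < 4 * \<rho>\<close> gives the constant 64.\<close>
    also have "\<dots> \<le> 8 * \<tau> * (2 * ratio ^ Suc n)"
      using pos ratio_gt by (intro mult_left_mono) auto
    also have "\<dots> < 64 * \<tau> * \<rho>"
      using pos n by simp
    finally show "norm (curve u - (curve t + slope n \<lfloor>2 ^ n * t\<rfloor> * of_real (u - t))) < 64 * \<tau> * \<rho>" .
  qed (rule slope_nonzero)
qed

end

section \<open>Transfer to the plane\<close>

theorem theorem5p3:
  fixes \<delta> :: real
  assumes "\<delta> > 0"
  shows "\<exists>A :: (real ^ 2) set. uniform_weak_approx 1 \<delta> A \<and> hausdorff_dim A > 1"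
proof -
  \<comment> \<open>The locale demands the first bound; the second turns the flatness error
    \<open>64 * \<tau> * \<rho>\<close> into at most \<open>\<delta> * \<rho>\<close>.\<close>
  define \<tau> where "\<tau> = min (1 / 32) (\<delta> / 64)"
  interpret flat_koch \<tau>
    by standard (use assms in \<open>auto simp: \<tau>_def\<close>)
  \<comment> \<open>Both spaces have real dimension 2, so a linear isometry carries the curve
    over.\<close>
  obtain h :: "complex \<Rightarrow> real ^ 2" where h: "linear h" "\<And>z. norm (h z) = norm z"
    by (rule isometry_subspaces[of "UNIV :: complex set" "UNIV :: (real ^ 2) set"]) auto
  have diff: "norm (h z - h w) = norm (z - w)" for z w
    by (simp add: linear_diff[OF h(1), symmetric] h(2))
  define g where "g = (\<lambda>t. h (curve t))"
  define A where "A = g ` {0..1}"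
  have dist_g: "dist (g t) (g u) = dist (curve t) (curve u)" for t u
    by (simp add: g_def dist_norm diff)
  have "1 < ennreal koch_dim" using koch_dim_gt_1 by (simp add: ennreal_lessI flip: ennreal_1)
  also have "\<dots> \<le> hausdorff_dim A"
    unfolding A_def
    by (rule hausdorff_dim_ge_of_expanding[of "4 powr koch_dim"])
      (simp, simp only: dist_g curve_inverse_holder)
  finally have dim: "hausdorff_dim A > 1" .
  have "uniform_weak_approx 1 \<delta> A"
    unfolding uniform_weak_approx_def
  proof (intro exI[of _ "2 :: real"] conjI ballI)
    \<comment> \<open>Radius 2 serves both demands: the curve has norm below 2, and its flatness is
      available for all \<open>\<rho> \<le> 2\<close>.\<close>
    show "\<exists>c. A \<subseteq> ball c 2"
      by (rule exI[of _ 0]) (auto simp: A_def g_def h(2) norm_curve_less)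
    fix y \<rho> assume "y \<in> A" and \<rho>: "\<rho> \<in> {0<..2::real}"
    then obtain t where t: "t \<in> {0..1}" and y: "y = g t" by (auto simp: A_def)
    obtain d where d: "d \<noteq> 0" "\<And>u. \<lbrakk>u \<in> {0..1}; norm (curve u - curve t) < \<rho>\<rbrakk>
      \<Longrightarrow> norm (curve u - (curve t + d * of_real (u - t))) < 64 * \<tau> * \<rho>"
      using curve_locally_flat[OF t, of \<rho>] \<rho> by auto
    define L where "L = affine hull {y, y + h d}"
    have L: "L = range (\<lambda>c. y + c *\<^sub>R h d)"
      unfolding L_def affine_hull_2_alt by simp
    have "h d \<noteq> 0" using d(1) h(2)[of d] by auto
    then have "aff_dim L = int 1" by (simp add: L_def)
    moreover have "ball y \<rho> \<inter> A \<subseteq> open_nbhd L (\<delta> * \<rho>)"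
    proof
      fix x assume x: "x \<in> ball y \<rho> \<inter> A"
      then obtain u where u: "u \<in> {0..1}" and xu: "x = g u" by (auto simp: A_def)
      have "norm (curve u - curve t) < \<rho>"
        using x by (simp add: xu y dist_g) (simp add: dist_norm norm_minus_commute)
      then have "norm (curve u - (curve t + d * of_real (u - t))) < 64 * \<tau> * \<rho>"
        using d(2) u by blast
      moreover have "h (curve t + d * of_real (u - t)) = y + (u - t) *\<^sub>R h d"
        using linear_scale[OF h(1), of "u - t" d]
        by (simp only: y g_def linear_add[OF h(1)] scaleR_conv_of_real[where 'a = complex] mult.commute)
      ultimately have "norm (x - (y + (u - t) *\<^sub>R h d)) < 64 * \<tau> * \<rho>"
        by (metis diff xu g_def)
      also have "\<dots> \<le> \<delta> * \<rho>"
        using \<rho> by (intro mult_right_mono) (auto simp: \<tau>_def)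
      finally show "x \<in> open_nbhd L (\<delta> * \<rho>)"
        unfolding open_nbhd_def L by blast
    qed
    moreover have "affine L" "y \<in> L" by (simp_all add: L_def hull_inc)
    ultimately show "\<exists>L. affine L \<and> aff_dim L = int 1 \<and> y \<in> L \<and> ball y \<rho> \<inter> A \<subseteq> open_nbhd L (\<delta> * \<rho>)"
      by blast
  qed simp
  with dim show ?thesis by blast
qed

end
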